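(* The sharp $\mathscr{S}^*_\wp$-radii are: (i) $R_{\mathscr{S}^*_\wp}(\mathcal{S}^*_L)=(2e-1)/e^2\approx0.600423$; (ii) $R_{\mathscr{S}^*_\wp}(\mathcal{S}^*_{RL})=\dfrac{1+2(\sqrt2-1)e}{e^2(\sqrt2-1)\left(\sqrt2-1+2(\sqrt2-1+e^{-1})^2\right)}\approx0.648826$; (iii) $R_{\mathscr{S}^*_\wp}(\mathcal{S}^*_e)=1-\ln(e-1)\approx0.458675$; (iv) $R_{\mathscr{S}^*_\wp}(\mathcal{S}^*_C)=1-\sqrt{1-3/(2e)}\approx0.330536$; (v) $R_{\mathscr{S}^*_\wp}(\mathcal{S}^*_s)=\arcsin(1/e)\approx0.376727$; (vi) $R_{\mathscr{S}^*_\wp}(\Delta^* )=(2e-1)/(2e(e-1))\approx0.474928$.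
   Context: $\mathbb{D}$ is the unit disk; $\mathcal{A}$ is the class of analytic $f$ on $\mathbb{D}$ with $f(0)=0,f'(0)=1$. $f\prec g$ means $f=g\circ\omega$ for analytic $\omega:\mathbb{D}\to\mathbb{D}$, $\omega(0)=0$. For analytic $\psi$, $\mathcal{S}^*(\psi)=\{f\in\mathcal{A}:zf'/f\prec\psi\}$. $\wp(z)=1+ze^z$, $\mathscr{S}^*_\wp=\mathcal{S}^*(\wp)$. Further $\mathcal{S}^*_L=\mathcal{S}^*(\sqrt{1+z})$, $\mathcal{S}^*_{RL}=\mathcal{S}^*\big(\sqrt2-(\sqrt2-1)\sqrt{(1-z)/(1+2(\sqrt2-1)z)}\big)$, $\mathcal{S}^*_e=\mathcal{S}^*(e^z)$, $\mathcal{S}^*_C=\mathcal{S}^*(1+\tfrac43z+\tfrac23z^2)$, $\mathcal{S}^*_s=\mathcal{S}^*(1+\sin z)$, $\Delta^*=\mathcal{S}^*(z+\sqrt{1+z^2})$ (principal branches). For classes $G_1,G_2$, $R_{G_1}(G_2)$ is the largest $r_0\in(0,1]$ such that $r^{-1}f(rz)\in G_1$ for all $0<r\le r_0$ and all $f\in G_2$; "sharp" means it cannot be increased. *)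

theory Defs
  imports "HOL-Analysis.Analysis"
begin

definition classA :: "(complex \<Rightarrow> complex) \<Rightarrow> bool" where
  "classA f \<longleftrightarrow> f holomorphic_on ball 0 1 \<and> f 0 = 0 \<and> deriv f 0 = 1"

definition subord :: "(complex \<Rightarrow> complex) \<Rightarrow> (complex \<Rightarrow> complex) \<Rightarrow> bool" where
  "subord p g \<longleftrightarrow> (\<exists>\<omega>. \<omega> holomorphic_on ball 0 1 \<and> \<omega> ` ball 0 1 \<subseteq> ball 0 1 \<and> \<omega> 0 = 0 \<and>
       (\<forall>z\<in>ball 0 1. p z = g (\<omega> z)))"

text \<open>The function z f'(z)/f(z), with its removable value 1 at z = 0.\<close>
definition logderiv_q :: "(complex \<Rightarrow> complex) \<Rightarrow> complex \<Rightarrow> complex" where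
  "logderiv_q f z = (if z = 0 then 1 else z * deriv f z / f z)"

text \<open>S*(psi). Analyticity of z f'/f on the disk forces f z \<noteq> 0 for z \<noteq> 0, which we require explicitly.\<close>
definition starlike_class :: "(complex \<Rightarrow> complex) \<Rightarrow> (complex \<Rightarrow> complex) set" where
  "starlike_class \<psi> = {f. classA f \<and> (\<forall>z\<in>ball 0 1. z \<noteq> 0 \<longrightarrow> f z \<noteq> 0) \<and>
        subord (logderiv_q f) \<psi>}"

definition wp :: "complex \<Rightarrow> complex" where "wp z = 1 + z * exp z"
definition psiL :: "complex \<Rightarrow> complex" where "psiL z = csqrt (1 + z)"
definition psiRL :: "complex \<Rightarrow> complex" where
  "psiRL z = complex_of_real (sqrt 2) - complex_of_real (sqrt 2 - 1) *
      csqrt ((1 - z) / (1 + 2 * complex_of_real (sqrt 2 - 1) * z))"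
definition psiE :: "complex \<Rightarrow> complex" where "psiE z = exp z"
definition psiC :: "complex \<Rightarrow> complex" where "psiC z = 1 + 4/3 * z + 2/3 * z^2"
definition psiS :: "complex \<Rightarrow> complex" where "psiS z = 1 + sin z"
definition psiDelta :: "complex \<Rightarrow> complex" where "psiDelta z = z + csqrt (1 + z^2)"

definition rescale :: "real \<Rightarrow> (complex \<Rightarrow> complex) \<Rightarrow> complex \<Rightarrow> complex" where
  "rescale r f = (\<lambda>z. f (complex_of_real r * z) / complex_of_real r)"

definition radius_good :: "(complex \<Rightarrow> complex) set \<Rightarrow> (complex \<Rightarrow> complex) set \<Rightarrow> real \<Rightarrow> bool" where
  "radius_good G1 G2 r0 \<longleftrightarrow> (\<forall>r. 0 < r \<and> r \<le> r0 \<longrightarrow> (\<forall>f\<in>G2. rescale r f \<in> G1))"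

definition is_radius :: "(complex \<Rightarrow> complex) set \<Rightarrow> (complex \<Rightarrow> complex) set \<Rightarrow> real \<Rightarrow> bool" where
  "is_radius G1 G2 R \<longleftrightarrow> 0 < R \<and> R \<le> 1 \<and> radius_good G1 G2 R \<and>
      (\<forall>r0. 0 < r0 \<and> r0 \<le> 1 \<and> radius_good G1 G2 r0 \<longrightarrow> r0 \<le> R)"

end

theory Submission
  imports Defs "HOL-Complex_Analysis.Complex_Analysis"
begin

text \<open>
  By Schwarz' lemma and the extremal \<open>f\<close> with \<open>z f'/f = \<psi>\<close>, for univalent \<open>\<phi>\<close> the \<open>S*(\<phi>)\<close>-radius of
  \<open>S*(\<psi>)\<close> is the largest \<open>r\<close> such that \<open>\<psi>\<close> maps \<open>\<bar>z\<bar> < r\<close> into the image of the unit disk under \<open>\<phi>\<close>.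
  The function \<open>wp\<close> is injective even on the closed unit disk, and \<open>\<bar>wp v - 2\<bar> \<ge> 1 + 1/e\<close> for \<open>\<bar>v\<bar> = 1\<close>.
  So \<open>wp\<close> maps the unit disk onto a set that contains the disk \<open>\<bar>w - 2\<bar> < 1 + 1/e\<close> but omits its
  boundary point \<open>wp (-1) = 1 - 1/e\<close>. For each of the six \<open>\<psi>\<close>, the maximum of \<open>\<bar>\<psi> z - 2\<bar>\<close> on a
  circle \<open>\<bar>z\<bar> = r \<le> R\<close> is attained at \<open>z = -r\<close>, where \<open>\<psi>\<close> is real and decreases with \<open>r\<close>, so that
  \<open>R\<close> is the solution of \<open>\<psi> (-R) = 1 - 1/e\<close>.
\<close>

subsection \<open>Elementary inequalities\<close>

lemma exp_minus_one_less: "exp (- 1) < (3 / 8 :: real)"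
proof -
  have "8 / 3 < exp (1 :: real)"
    using e_approx_32 by (simp add: abs_if split: if_split_asm)
  then show ?thesis by (simp add: exp_minus field_simps)
qed

lemma sqrt_2_bounds: "7 / 5 < sqrt 2" "sqrt 2 < 3 / 2"
  by (rule real_less_rsqrt real_less_lsqrt; simp add: power2_eq_square)+

lemma norm_diff_of_real_squared:
  "(norm (w - of_real a))\<^sup>2 = (norm w)\<^sup>2 - 2 * a * Re w + a\<^sup>2" for w :: complex
  unfolding cmod_power2 by (simp add: power2_eq_square algebra_simps)

lemma one_plus_notin_nonpos_Reals: "1 + z \<notin> \<real>\<^sub>\<le>\<^sub>0" if "norm z < 1" for z :: complex
  using that abs_Re_le_cmod[of z] by (auto simp: complex_nonpos_Reals_iff)

lemma exp_le_quadratic: "exp x \<le> 1 + x + x\<^sup>2" if "x \<le> 1" for x :: real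
proof (cases "0 \<le> x")
  case True
  then show ?thesis using that by (rule exp_bound)
next
  case False
  have "exp x * (1 - x) \<le> exp x * exp (- x)"
    using exp_ge_add_one_self[of "- x"] by (intro mult_left_mono) auto
  also have "\<dots> = 1" by (simp flip: exp_add)
  also have "1 \<le> 1 - x * x\<^sup>2"
    using False by (simp add: mult_nonpos_nonneg)
  also have "\<dots> = (1 + x + x\<^sup>2) * (1 - x)"
    by (simp add: power2_eq_square algebra_simps)
  finally show ?thesis using False by simp
qed

lemma cosh_le_quadratic: "cosh y \<le> 1 + y\<^sup>2" if "\<bar>y\<bar> \<le> 1" for y :: real
proof -
  have "exp y + exp (- y) \<le> (1 + y + y\<^sup>2) + (1 + - y + (- y)\<^sup>2)"
    using that by (intro add_mono exp_le_quadratic) auto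
  then show ?thesis by (simp add: cosh_field_def)
qed

lemma cos_ge_quadratic: "1 - x\<^sup>2 / 2 \<le> cos x" for x :: real
proof -
  have "(sin (x / 2))\<^sup>2 \<le> (x / 2)\<^sup>2"
    using abs_sin_x_le_abs_x[of "x / 2"] by (simp only: abs_le_square_iff)
  then show ?thesis
    using cos_double_sin[of "x / 2"] by (simp add: power2_eq_square)
qed

lemma times_sin_ge_quartic: "x\<^sup>2 - x ^ 4 / 6 \<le> x * sin x" for x :: real
proof -
  have "\<bar>sin x - x\<bar> \<le> \<bar>x\<bar> ^ 3 / 6"
    using Maclaurin_sin_bound[of x 3]
    by (simp add: numeral_3_eq_3 sin_coeff_def fact_numeral divide_simps)
  then have "\<bar>x\<bar> * \<bar>sin x - x\<bar> \<le> \<bar>x\<bar> * (\<bar>x\<bar> ^ 3 / 6)"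
    by (rule mult_left_mono) simp
  also have "\<bar>x\<bar> * (\<bar>x\<bar> ^ 3 / 6) = x ^ 4 / 6"
    by (simp add: power4_eq_xxxx power3_eq_cube abs_if)
  finally have "\<bar>x * sin x - x\<^sup>2\<bar> \<le> x ^ 4 / 6"
    by (simp add: abs_mult[symmetric] algebra_simps power2_eq_square)
  then show ?thesis by linarith
qed

lemma sin_diff_ge:
  fixes a b c :: real
  assumes "a \<le> b" "- c \<le> a" "b \<le> c"
  shows "(1 - c\<^sup>2 / 2) * (b - a) \<le> sin b - sin a"
proof -
  let ?g = "\<lambda>t. sin t - (1 - c\<^sup>2 / 2) * t"
  have "?g a \<le> ?g b"
  proof (rule DERIV_nonneg_imp_nondecreasing[OF \<open>a \<le> b\<close>])
    fix t assume "a \<le> t" "t \<le> b"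
    then have "t\<^sup>2 \<le> c\<^sup>2" using assms by (intro abs_le_square_iff[THEN iffD1]) auto
    then have "0 \<le> cos t - (1 - c\<^sup>2 / 2)" using cos_ge_quadratic[of t] by simp
    moreover have "(?g has_real_derivative cos t - (1 - c\<^sup>2 / 2)) (at t)"
      by (auto intro!: derivative_eq_intros)
    ultimately show "\<exists>d. (?g has_real_derivative d) (at t) \<and> 0 \<le> d" by blast
  qed
  then show ?thesis by (simp add: algebra_simps diff_divide_distrib)
qed

subsection \<open>Subordination and starlike classes\<close>

lemma of_real_mult_image_ball:
  assumes "0 < r"
  shows "(\<lambda>z :: complex. of_real r * z) ` ball 0 1 = ball 0 r"
  using assms ball_scale[of r "0 :: complex" 1] by (simp add: scaleR_conv_of_real[abs_def])

lemma of_real_mult_in_unit_ball: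
  fixes z :: complex
  assumes "0 < r" "r \<le> 1" "z \<in> ball 0 1"
  shows "of_real r * z \<in> ball 0 1"
  using assms mult_right_mono[OF assms(2), of "norm z"] by (simp add: norm_mult)

lemma subord_refl: "subord p p"
  unfolding subord_def by (rule exI[of _ "\<lambda>z. z"]) auto

lemma subord_imp_holomorphic:
  assumes "subord p g" "g holomorphic_on ball 0 1"
  shows "p holomorphic_on ball 0 1"
proof -
  obtain \<omega> where \<omega>: "\<omega> holomorphic_on ball 0 1" "\<omega> ` ball 0 1 \<subseteq> ball 0 1"
    and p: "\<And>z. z \<in> ball 0 1 \<Longrightarrow> p z = g (\<omega> z)"
    using assms(1) unfolding subord_def by blast
  have "g \<circ> \<omega> holomorphic_on ball 0 1"
    using \<omega>(1) assms(2) \<omega>(2) by (rule holomorphic_on_compose_gen)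
  then show ?thesis by (rule holomorphic_transform) (simp add: p)
qed

lemma subord_image_ball_subset:
  assumes "subord p g" "r \<le> 1"
  shows "p ` ball 0 r \<subseteq> g ` ball 0 r"
proof -
  obtain \<omega> where \<omega>: "\<omega> holomorphic_on ball 0 1" "\<omega> ` ball 0 1 \<subseteq> ball 0 1" "\<omega> 0 = 0"
    and p: "\<And>z. z \<in> ball 0 1 \<Longrightarrow> p z = g (\<omega> z)"
    using assms(1) unfolding subord_def by blast
  have Schwarz: "norm (\<omega> z) \<le> norm z" if "norm z < 1" for z
    by (rule Schwarz_Lemma(1)[OF \<omega>(1,3) _ that]) (use \<omega>(2) in force)
  show ?thesis
  proof (rule image_subsetI)
    fix z :: complex assume "z \<in> ball 0 r"
    then have z: "norm z < r" "norm z < 1" using assms(2) by auto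
    then have "\<omega> z \<in> ball 0 r" using Schwarz[of z] by simp
    then show "p z \<in> g ` ball 0 r" using p[of z] z by simp
  qed
qed

lemma subord_univalentI:
  assumes p: "p holomorphic_on ball 0 1" and g: "g holomorphic_on ball 0 1" "inj_on g (ball 0 1)"
    and "p 0 = g 0" and image: "p ` ball 0 1 \<subseteq> g ` ball 0 1"
  shows "subord p g"
proof -
  obtain h where h: "h holomorphic_on g ` ball 0 1" "\<And>z. z \<in> ball 0 1 \<Longrightarrow> h (g z) = z"
    by (rule holomorphic_has_inverse[OF g(1) open_ball g(2)]) blast
  have "h \<circ> p holomorphic_on ball 0 1"
    using p h(1) image by (rule holomorphic_on_compose_gen)
  moreover have "(h \<circ> p) ` ball 0 1 \<subseteq> ball 0 1" "\<forall>z\<in>ball 0 1. p z = g ((h \<circ> p) z)"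
    using h(2) image by force+
  moreover have "(h \<circ> p) 0 = 0"
    using h(2)[of 0] \<open>p 0 = g 0\<close> by simp
  ultimately show ?thesis unfolding subord_def by blast
qed

lemma rescale_has_field_derivative:
  assumes "f holomorphic_on ball 0 1" and "0 < r" "r \<le> 1" and "z \<in> ball 0 1"
  shows "(rescale r f has_field_derivative deriv f (of_real r * z)) (at z)"
proof -
  have "of_real r * z \<in> ball 0 1"
    using assms(2-4) by (rule of_real_mult_in_unit_ball)
  then have "(f has_field_derivative deriv f (of_real r * z)) (at (of_real r * z))"
    using assms(1) by (simp add: holomorphic_derivI)
  then have "((\<lambda>z. f (of_real r * z)) has_field_derivative deriv f (of_real r * z) * of_real r) (at z)"
    using DERIV_cmult_Id by (rule DERIV_chain2)
  from DERIV_cdivide[OF this, of "of_real r"] show ?thesis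
    using assms(2) by (simp add: rescale_def)
qed

lemma classA_rescale:
  assumes "classA f" and "0 < r" "r \<le> 1"
  shows "classA (rescale r f)"
proof -
  note deriv = rescale_has_field_derivative[of f r, OF _ assms(2,3)]
  have "rescale r f holomorphic_on ball 0 1"
    unfolding holomorphic_on_open[OF open_ball] using deriv assms(1) classA_def by blast
  moreover have "deriv (rescale r f) 0 = 1"
    using DERIV_imp_deriv[OF deriv[of 0]] assms(1) by (simp add: classA_def)
  ultimately show ?thesis using assms(1) by (simp add: classA_def rescale_def)
qed

lemma logderiv_q_rescale:
  assumes "f holomorphic_on ball 0 1" and "0 < r" "r \<le> 1" and "z \<in> ball 0 1"
  shows "logderiv_q (rescale r f) z = logderiv_q f (of_real r * z)"
  using assms DERIV_imp_deriv[OF rescale_has_field_derivative[OF assms]]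
  by (simp add: logderiv_q_def) (simp add: rescale_def)

lemma logderiv_q_rescale_image:
  assumes "f holomorphic_on ball 0 1" and "0 < r" "r \<le> 1"
  shows "logderiv_q (rescale r f) ` ball 0 1 = logderiv_q f ` ball 0 r"
  unfolding of_real_mult_image_ball[OF assms(2), symmetric] image_image
  by (intro image_cong refl logderiv_q_rescale assms)

lemma exists_starlike_logderiv_q:
  assumes psi: "\<psi> holomorphic_on ball 0 1" "\<psi> 0 = 1"
  obtains f where "f \<in> starlike_class \<psi>" "\<And>z. z \<in> ball 0 1 \<Longrightarrow> logderiv_q f z = \<psi> z"
proof -
  define q where "q = (\<lambda>z. if z = 0 then deriv \<psi> 0 else (\<psi> z - \<psi> 0) / (z - 0))"
  have q: "z * q z = \<psi> z - 1" for z
    by (cases "z = 0") (simp_all add: q_def psi(2))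
  have "q holomorphic_on ball 0 1"
    unfolding q_def by (rule pole_lemma) (use psi in auto)
  then obtain G where "\<And>z. z \<in> ball 0 1 \<Longrightarrow> (G has_field_derivative q z) (at z within ball 0 1)"
    by (rule holomorphic_convex_primitive'[OF convex_ball open_ball]) blast
  then have G: "(G has_field_derivative q z) (at z)" if "z \<in> ball 0 1" for z
    using that by (simp add: at_within_open[OF _ open_ball])
  define f where "f = (\<lambda>z. z * exp (G z - G 0))"
  have f: "(f has_field_derivative \<psi> z * exp (G z - G 0)) (at z)" if "z \<in> ball 0 1" for z
  proof -
    have "(f has_field_derivative (1 + z * q z) * exp (G z - G 0)) (at z)"
      unfolding f_def using G[OF that]
      by (auto intro!: derivative_eq_intros simp: algebra_simps)
    then show ?thesis by (simp add: q)
  qed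
  have "f holomorphic_on ball 0 1"
    unfolding holomorphic_on_open[OF open_ball] using f by blast
  then have "classA f"
    using DERIV_imp_deriv[OF f[of 0]] psi(2) by (simp add: classA_def f_def)
  moreover have logderiv: "logderiv_q f z = \<psi> z" if "z \<in> ball 0 1" for z
    using DERIV_imp_deriv[OF f[OF that]] psi(2) by (simp add: logderiv_q_def f_def)
  then have "subord (logderiv_q f) \<psi>"
    using subord_refl[of \<psi>] by (simp add: subord_def)
  ultimately have "f \<in> starlike_class \<psi>"
    by (simp add: starlike_class_def f_def)
  then show ?thesis using logderiv that by blast
qed

lemma radius_good_starlike_classD:
  assumes good: "radius_good (starlike_class \<phi>) (starlike_class \<psi>) r"
    and psi: "\<psi> holomorphic_on ball 0 1" "\<psi> 0 = 1" and r: "0 < r" "r \<le> 1"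
  shows "\<psi> ` ball 0 r \<subseteq> \<phi> ` ball 0 1"
proof -
  obtain f where f: "f \<in> starlike_class \<psi>" "\<And>z. z \<in> ball 0 1 \<Longrightarrow> logderiv_q f z = \<psi> z"
    using exists_starlike_logderiv_q[OF psi] by blast
  have "\<psi> ` ball 0 r = logderiv_q f ` ball 0 r"
    using f(2) r by (intro image_cong) auto
  also have "\<dots> = logderiv_q (rescale r f) ` ball 0 1"
    using f(1) by (intro logderiv_q_rescale_image[symmetric] r) (simp add: starlike_class_def classA_def)
  also have "\<dots> \<subseteq> \<phi> ` ball 0 1"
    using good f(1) r by (intro subord_image_ball_subset) (auto simp: radius_good_def starlike_class_def)
  finally show ?thesis .
qed

lemma rescale_in_starlike_class:
  assumes phi: "\<phi> holomorphic_on ball 0 1" "inj_on \<phi> (ball 0 1)" "\<phi> 0 = 1"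
    and psi: "\<psi> holomorphic_on ball 0 1" and r: "0 < r" "r \<le> 1"
    and image: "\<psi> ` ball 0 r \<subseteq> \<phi> ` ball 0 1" and f: "f \<in> starlike_class \<psi>"
  shows "rescale r f \<in> starlike_class \<phi>"
proof -
  have "classA f" and nonzero: "\<And>z. z \<in> ball 0 1 \<Longrightarrow> z \<noteq> 0 \<Longrightarrow> f z \<noteq> 0"
    and sub: "subord (logderiv_q f) \<psi>"
    using f by (auto simp: starlike_class_def)
  then have hol: "f holomorphic_on ball 0 1" by (simp add: classA_def)
  have scaled: "of_real r * z \<in> ball 0 1" if "z \<in> ball 0 1" for z :: complex
    using of_real_mult_in_unit_ball[OF r that] .
  have "(\<lambda>z :: complex. of_real r * z) ` ball 0 1 \<subseteq> ball 0 1" using scaled by blast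
  then have "(logderiv_q f \<circ> (\<lambda>z. of_real r * z)) holomorphic_on ball 0 1"
    by (intro holomorphic_on_compose_gen[OF _ subord_imp_holomorphic[OF sub psi]] holomorphic_intros)
  then have "logderiv_q (rescale r f) holomorphic_on ball 0 1"
    by (rule holomorphic_transform) (simp add: logderiv_q_rescale[OF hol r])
  moreover have "logderiv_q (rescale r f) ` ball 0 1 \<subseteq> \<phi> ` ball 0 1"
    using subord_image_ball_subset[OF sub r(2)] image
    unfolding logderiv_q_rescale_image[OF hol r] by (rule order_trans)
  ultimately have "subord (logderiv_q (rescale r f)) \<phi>"
    using phi by (intro subord_univalentI) (auto simp: logderiv_q_def)
  moreover have "rescale r f z \<noteq> 0" if "z \<in> ball 0 1" "z \<noteq> 0" for z
    using nonzero[OF scaled[OF that(1)]] that r by (simp add: rescale_def)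
  ultimately show ?thesis
    using classA_rescale[OF \<open>classA f\<close> r] by (simp add: starlike_class_def)
qed

lemma radius_good_starlike_class_iff:
  assumes phi: "\<phi> holomorphic_on ball 0 1" "inj_on \<phi> (ball 0 1)" "\<phi> 0 = 1"
    and psi: "\<psi> holomorphic_on ball 0 1" "\<psi> 0 = 1" and r: "0 < r" "r \<le> 1"
  shows "radius_good (starlike_class \<phi>) (starlike_class \<psi>) r \<longleftrightarrow> \<psi> ` ball 0 r \<subseteq> \<phi> ` ball 0 1"
proof
  assume "radius_good (starlike_class \<phi>) (starlike_class \<psi>) r"
  then show "\<psi> ` ball 0 r \<subseteq> \<phi> ` ball 0 1"
    using psi r by (rule radius_good_starlike_classD)
next
  assume image: "\<psi> ` ball 0 r \<subseteq> \<phi> ` ball 0 1"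
  have "\<psi> ` ball 0 \<rho> \<subseteq> \<phi> ` ball 0 1" if "\<rho> \<le> r" for \<rho>
    using image_mono[OF subset_ball[OF that], of \<psi>] image by (rule order_trans)
  then show "radius_good (starlike_class \<phi>) (starlike_class \<psi>) r"
    unfolding radius_good_def using r by (auto intro!: rescale_in_starlike_class[OF phi psi(1)])
qed

lemma is_radius_starlike_classI:
  assumes "\<phi> holomorphic_on ball 0 1" "inj_on \<phi> (ball 0 1)" "\<phi> 0 = 1"
    and "\<psi> holomorphic_on ball 0 1" "\<psi> 0 = 1" and R: "0 < R" "R \<le> 1"
    and image: "\<psi> ` ball 0 R \<subseteq> \<phi> ` ball 0 1"
    and omitted: "norm \<zeta> = R" "\<psi> \<zeta> \<notin> \<phi> ` ball 0 1"
  shows "is_radius (starlike_class \<phi>) (starlike_class \<psi>) R"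
proof -
  note iff = radius_good_starlike_class_iff[OF assms(1-5)]
  have "r \<le> R" if "0 < r" "r \<le> 1" "radius_good (starlike_class \<phi>) (starlike_class \<psi>) r" for r
  proof (rule ccontr)
    assume "\<not> r \<le> R"
    then have "\<psi> \<zeta> \<in> \<psi> ` ball 0 r" using omitted(1) by (intro imageI) simp
    moreover have "\<psi> ` ball 0 r \<subseteq> \<phi> ` ball 0 1" using that(3) iff[OF that(1,2)] by simp
    ultimately show False using omitted(2) by blast
  qed
  moreover have "radius_good (starlike_class \<phi>) (starlike_class \<psi>) R"
    using image iff[OF R] by simp
  ultimately show ?thesis using R by (simp add: is_radius_def)
qed

subsection \<open>The image of the unit disk under \<open>1 + z e\<^sup>z\<close>\<close>

lemma norm_exp_minus_one_le:
  assumes "Re u \<le> 0"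
  shows "norm (exp u - 1) \<le> norm u"
proof -
  have "norm (exp u - exp 0) \<le> 1 * norm (u - 0)"
  proof (rule field_differentiable_bound[where f' = exp])
    show "convex {z. Re z \<le> 0}" by (rule convex_halfspace_Re_le)
  qed (use assms in \<open>auto intro!: derivative_eq_intros\<close>)
  then show ?thesis by simp
qed

lemma norm_add_one_less_2:
  fixes w :: complex
  assumes "norm w \<le> 1" "w \<noteq> 1"
  shows "norm (w + 1) < 2"
proof (rule power2_less_imp_less)
  have "(norm (w + 1))\<^sup>2 = 2 * (norm w)\<^sup>2 + 2 - (norm (w - 1))\<^sup>2"
    unfolding cmod_power2 by (simp add: power2_eq_square algebra_simps)
  moreover have "(norm w)\<^sup>2 \<le> 1" using assms(1) by (simp add: power_le_one)
  moreover have "0 < (norm (w - 1))\<^sup>2" using assms(2) by simp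
  ultimately have "(norm (w + 1))\<^sup>2 < 4" by linarith
  then show "(norm (w + 1))\<^sup>2 < 2\<^sup>2" by simp
qed simp

lemma norm_exp_minus_one_less:
  assumes "Re u \<le> 0" "u \<noteq> 0"
  shows "norm (exp u - 1) < norm u"
proof (cases "exp (u / 2) = 1")
  case True
  then have "exp u = 1" using exp_double[of "u / 2"] by simp
  then show ?thesis using assms(2) by simp
next
  case False
  have "exp u - 1 = (exp (u / 2) - 1) * (exp (u / 2) + 1)"
    using exp_double[of "u / 2"] by (simp add: power2_eq_square algebra_simps)
  then have "norm (exp u - 1) = norm (exp (u / 2) - 1) * norm (exp (u / 2) + 1)"
    by (simp only: norm_mult)
  also have "\<dots> \<le> norm (u / 2) * norm (exp (u / 2) + 1)"
    using assms(1) by (intro mult_right_mono norm_exp_minus_one_le) auto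
  also have "\<dots> < norm (u / 2) * 2"
    using False assms by (intro mult_strict_left_mono norm_add_one_less_2) auto
  finally show ?thesis by simp
qed

lemma times_exp_cancel:
  assumes eq: "z * exp z = w * exp w" and "norm w \<le> 1" and "Re w \<le> Re z"
  shows "z = w"
proof (rule ccontr)
  assume "z \<noteq> w"
  have "z = w * exp (w - z)"
    using eq by (simp add: exp_diff field_simps)
  then have "z - w = w * (exp (w - z) - 1)"
    by (simp add: algebra_simps)
  then have "norm (w - z) = norm w * norm (exp (w - z) - 1)"
    by (metis norm_minus_commute norm_mult)
  also have "\<dots> \<le> 1 * norm (exp (w - z) - 1)"
    using \<open>norm w \<le> 1\<close> by (intro mult_right_mono) auto
  also have "\<dots> < norm (w - z)"
    using norm_exp_minus_one_less[of "w - z"] \<open>Re w \<le> Re z\<close> \<open>z \<noteq> w\<close> by simp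
  finally show False by simp
qed

lemma holomorphic_on_wp: "wp holomorphic_on S"
  unfolding wp_def by (intro holomorphic_intros)

lemma inj_on_wp: "inj_on wp (cball 0 1)"
proof (rule inj_onI)
  fix z w assume "z \<in> cball 0 1" "w \<in> cball 0 1" "wp z = wp w"
  then show "z = w"
    using times_exp_cancel[of z w] times_exp_cancel[of w z]
    by (cases "Re w \<le> Re z") (auto simp: wp_def)
qed

lemma wp_minus_one_notin_image: "wp (- 1) \<notin> wp ` ball 0 1"
  using inj_on_image_mem_iff[OF inj_on_wp, of "- 1" "ball 0 1"] by auto

lemma exp_le_times_cos_plus_times_sin:
  fixes p s :: real
  assumes p: "0 \<le> p" "p \<le> 1" and s: "p\<^sup>2 + s\<^sup>2 = 1"
  shows "exp (p - 1) \<le> p * cos s + s * sin s"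
proof -
  let ?g = "p * (1 - s\<^sup>2 / 2) + (s\<^sup>2 - s ^ 4 / 6)"
  have "exp (p - 1) * (2 - p) \<le> exp (p - 1) * exp (1 - p)"
    using exp_ge_add_one_self[of "1 - p"] by (intro mult_left_mono) auto
  also have "\<dots> = 1" by (simp flip: exp_add)
  also have "1 \<le> 1 + (1 - p) * (1 - (1 - p) / 6 - (1 - p) ^ 4 / 6)"
  proof -
    have "0 \<le> 1 - (1 - p) / 6 - (1 - p) ^ 4 / 6"
      using p power_le_one[of "1 - p" 4] by (simp add: field_simps)
    then show ?thesis using p by simp
  qed
  also have "\<dots> = (2 - p) * ?g"
  proof -
    have s2: "s\<^sup>2 = 1 - p\<^sup>2" using s by simp
    have s4: "s ^ 4 = (1 - p\<^sup>2)\<^sup>2" by (simp flip: s2)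
    show ?thesis
      unfolding s2 s4 by (simp add: field_simps power2_eq_square power3_eq_cube power4_eq_xxxx)
  qed
  finally have "exp (p - 1) \<le> ?g" using p by (simp add: mult.commute)
  also have "\<dots> \<le> p * cos s + s * sin s"
    using p by (intro add_mono mult_left_mono cos_ge_quadratic times_sin_ge_quartic)
  finally show ?thesis .
qed

lemma Re_times_exp_le:
  assumes "norm v = 1" "Re v \<le> 0"
  shows "Re (v * exp v) \<le> - exp (- 1)"
proof -
  have circle: "(- Re v)\<^sup>2 + (Im v)\<^sup>2 = 1"
    using assms(1) cmod_power2[of v] by simp
  have "exp (- Re v - 1) \<le> - Re v * cos (Im v) + Im v * sin (Im v)"
    using assms abs_Re_le_cmod[of v] circle by (intro exp_le_times_cos_plus_times_sin) auto
  then have "exp (Re v) * exp (- Re v - 1) \<le> exp (Re v) * (- Re v * cos (Im v) + Im v * sin (Im v))"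
    by (intro mult_left_mono) auto
  also have "exp (Re v) * exp (- Re v - 1) = exp (- 1)" by (simp flip: exp_add)
  also have "exp (Re v) * (- Re v * cos (Im v) + Im v * sin (Im v)) = - Re (v * exp v)"
    by (simp add: Re_exp Im_exp algebra_simps)
  finally show ?thesis by simp
qed

lemma norm_times_exp_minus_one_ge_sqrt_2:
  assumes "norm v = 1" "0 \<le> Re v"
  shows "sqrt 2 \<le> norm (v * exp v - 1)"
proof (rule real_le_lsqrt)
  define c s where "c = Re v" and "s = Im v"
  have c: "0 \<le> c" "c \<le> 1" and s: "\<bar>s\<bar> \<le> 1"
    using assms abs_Re_le_cmod[of v] abs_Im_le_cmod[of v] by (auto simp: c_def s_def)
  have "0 \<le> s * sin s"
    using s sin_ge_zero[of s] sin_ge_zero[of "- s"] pi_gt3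
    by (cases "0 \<le> s") (auto simp: mult_nonpos_nonpos)
  moreover have "c * cos s \<le> c * 1" using c by (intro mult_left_mono) auto
  ultimately have "exp c * (c * cos s - s * sin s) \<le> exp c * c"
    by (intro mult_left_mono) auto
  then have re: "Re (v * exp v) \<le> exp c * c"
    by (simp add: c_def s_def Re_exp Im_exp algebra_simps)
  have "2 \<le> 1 + (1 + (c\<^sup>2 / 2)\<^sup>2)" by simp
  also have "\<dots> = 1 + (1 + c + c\<^sup>2 / 2) * (1 + c + c\<^sup>2 / 2 - 2 * c)"
    by (simp add: field_simps power2_eq_square)
  also have "\<dots> \<le> 1 + exp c * (exp c - 2 * c)"
    using exp_lower_Taylor_quadratic[OF c(1)] c zero_le_power2[of c]
    by (intro add_left_mono mult_mono) linarith+
  also have "\<dots> \<le> (norm (v * exp v))\<^sup>2 - 2 * Re (v * exp v) + 1"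
    using re assms(1) by (simp add: norm_mult c_def power2_eq_square algebra_simps)
  also have "\<dots> = (norm (v * exp v - 1))\<^sup>2"
    using norm_diff_of_real_squared[of "v * exp v" 1] by simp
  finally show "2 \<le> (norm (v * exp v - 1))\<^sup>2" .
qed auto

lemma norm_wp_minus_2_ge:
  assumes "norm v = 1"
  shows "1 + exp (- 1) \<le> norm (wp v - 2)"
proof -
  have "1 + exp (- 1) \<le> norm (v * exp v - 1)"
  proof (cases "Re v \<le> 0")
    case True
    then have "1 + exp (- 1) \<le> \<bar>Re (v * exp v - 1)\<bar>"
      using Re_times_exp_le[OF assms] by simp
    then show ?thesis using abs_Re_le_cmod by (rule order_trans)
  next
    case False
    have "1 + exp (- 1) \<le> sqrt 2"
      using exp_minus_one_less sqrt_2_bounds(1) by linarith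
    then show ?thesis
      using norm_times_exp_minus_one_ge_sqrt_2[OF assms] False by linarith
  qed
  then show ?thesis by (simp add: wp_def)
qed

lemma ball_subset_wp_image: "ball 2 (1 + exp (- 1)) \<subseteq> wp ` ball 0 1"
proof -
  have "\<exists>a. 0 \<le> a \<and> a \<le> 1 \<and> a * exp a = (1 :: real)"
    using exp_ge_add_one_self[of 1] by (intro IVT') (auto intro!: continuous_intros)
  then obtain a :: real where a: "0 \<le> a" "a \<le> 1" "a * exp a = 1" by blast
  then have "a < 1" by (cases "a = 1") auto
  have "of_real a * exp (complex_of_real a) = of_real (a * exp a)"
    by (simp add: exp_of_real)
  then have wp_a: "wp (of_real a) = 2"
    using a(3) by (simp add: wp_def)
  have "ball (wp (of_real a)) (1 + exp (- 1)) \<subseteq> wp ` ball 0 1"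
  proof (rule ball_subset_open_map_image)
    have "open (wp ` ball 0 1)"
      by (intro open_mapping_thm3 holomorphic_on_wp inj_on_subset[OF inj_on_wp]) auto
    then show "open (wp ` interior (ball 0 1))" by simp
    show "1 + exp (- 1) \<le> norm (wp z - wp (of_real a))" if "z \<in> frontier (ball 0 1)" for z
      using that norm_wp_minus_2_ge by (simp add: wp_a)
    show "complex_of_real a \<in> ball 0 1" using a \<open>a < 1\<close> by simp
  qed (auto intro: holomorphic_on_imp_continuous_on holomorphic_on_wp add_pos_pos)
  then show ?thesis by (simp only: wp_a)
qed

lemma is_radius_starlike_wpI:
  fixes m :: "real \<Rightarrow> real"
  assumes R: "0 < R" "R \<le> 1" and psi: "\<psi> holomorphic_on ball 0 1" "\<psi> 0 = 1"
    and bound: "\<And>z. norm z < R \<Longrightarrow> norm (\<psi> z - 2) \<le> 2 - m (norm z)"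
    and m: "strict_antimono_on {0..R} m" "m R = 1 - exp (- 1)" "\<psi> (- of_real R) = of_real (m R)"
  shows "is_radius (starlike_class wp) (starlike_class \<psi>) R"
proof (rule is_radius_starlike_classI)
  show "wp holomorphic_on ball 0 1" by (rule holomorphic_on_wp)
  show "inj_on wp (ball 0 1)" by (rule inj_on_subset[OF inj_on_wp]) auto
  show "wp 0 = 1" by (simp add: wp_def)
  show "\<psi> ` ball 0 R \<subseteq> wp ` ball 0 1"
  proof (rule order_trans[OF image_subsetI ball_subset_wp_image])
    fix z :: complex assume "z \<in> ball 0 R"
    then have "norm z < R" by simp
    then have "m R < m (norm z)" using m(1) R by (auto simp: monotone_on_def)
    then have "norm (\<psi> z - 2) < 1 + exp (- 1)"
      using bound[OF \<open>norm z < R\<close>] m(2) by simp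
    then show "\<psi> z \<in> ball 2 (1 + exp (- 1))" by (simp add: dist_norm norm_minus_commute)
  qed
  show "norm (- complex_of_real R) = R" using R by simp
  have "\<psi> (- of_real R) = wp (- 1)"
    using m(2,3) by (simp add: wp_def flip: exp_of_real)
  then show "\<psi> (- of_real R) \<notin> wp ` ball 0 1"
    using wp_minus_one_notin_image by simp
qed (use R psi in auto)

subsection \<open>The lemniscate class\<close>

lemma norm_csqrt_one_plus_minus_one_le:
  assumes "norm z \<le> 1"
  shows "norm (csqrt (1 + z) - 1) \<le> 1 - sqrt (1 - norm z)"
proof -
  define s where "s = csqrt (1 + z)"
  define d where "d = norm (s - 1)"
  have "s\<^sup>2 = 1 + z" by (simp add: s_def)
  then have "z = (s - 1) * (s + 1)"
    by (simp add: algebra_simps power2_eq_square)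
  then have z: "norm z = d * norm (s + 1)" by (metis norm_mult d_def)
  have "0 \<le> Re s" unfolding s_def by (rule Re_csqrt)
  then have "1 \<le> norm (s + 1)"
    using abs_Re_le_cmod[of "s + 1"] by simp
  then have "d * 1 \<le> norm z" unfolding z by (intro mult_left_mono) (auto simp: d_def)
  moreover have "2 - d \<le> norm (s + 1)"
    using norm_triangle_ineq4[of "s + 1" "s - 1"] by (simp add: d_def)
  then have "d * (2 - d) \<le> norm z" unfolding z by (intro mult_left_mono) (auto simp: d_def)
  then have "1 - norm z \<le> (1 - d)\<^sup>2" by (simp add: power2_eq_square algebra_simps)
  ultimately have "sqrt (1 - norm z) \<le> 1 - d"
    using assms by (intro real_le_lsqrt) auto
  then show ?thesis by (simp add: s_def d_def)
qed

lemma is_radius_psiL: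
  "is_radius (starlike_class wp) (starlike_class psiL) ((2 * exp 1 - 1) / exp 1 ^ 2)"
proof -
  define R :: real where "R = 1 - (1 - exp (- 1))\<^sup>2"
  have R: "0 < R" "R \<le> 1" by (simp_all add: R_def abs_square_less_1 abs_less_iff)
  have "is_radius (starlike_class wp) (starlike_class psiL) R"
  proof (rule is_radius_starlike_wpI[where m = "\<lambda>r. sqrt (1 - r)"])
    show "psiL holomorphic_on ball 0 1"
      unfolding psiL_def by (intro holomorphic_intros one_plus_notin_nonpos_Reals) auto
    show "norm (psiL z - 2) \<le> 2 - sqrt (1 - norm z)" if "norm z < R" for z
      using norm_csqrt_one_plus_minus_one_le[of z] norm_triangle_ineq4[of "csqrt (1 + z) - 1" 1] that R
      by (simp add: psiL_def)
    show "strict_antimono_on {0..R} (\<lambda>r. sqrt (1 - r))" by (simp add: monotone_on_def)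
    show "sqrt (1 - R) = 1 - exp (- 1)" by (simp add: R_def)
    show "psiL (- of_real R) = of_real (sqrt (1 - R))"
      using R csqrt_of_real_nonneg[of "of_real (1 - R)"] by (simp add: psiL_def)
  qed (use R in \<open>simp_all add: psiL_def\<close>)
  also have "R = (2 * exp 1 - 1) / exp 1 ^ 2"
    by (simp add: R_def exp_minus field_simps power2_eq_square)
  finally show ?thesis .
qed

subsection \<open>The reverse lemniscate class\<close>

lemma norm_Moebius_le:
  fixes z :: "'a :: real_normed_field"
  assumes "0 \<le> a" "a * norm z < 1"
  shows "norm ((1 - z) / (1 + of_real a * z)) \<le> (1 + norm z) / (1 - a * norm z)"
  unfolding norm_divide
proof (rule frac_le)
  show "norm (1 - z) \<le> 1 + norm z" using norm_triangle_ineq4[of 1 z] by simp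
  show "1 - a * norm z \<le> norm (1 + of_real a * z)"
    using norm_diff_ineq[of 1 "of_real a * z"] assms(1) by (simp add: norm_mult)
qed (use assms in auto)

lemma Re_Moebius_pos:
  assumes a: "0 \<le> a" "a \<le> 1" and z: "norm z < 1"
  shows "0 < Re ((1 - z) / (1 + of_real a * z))"
  unfolding Re_complex_div_gt_0
proof -
  have "(1 - a) * Re z \<le> (1 - a) * norm z"
    using a complex_Re_le_cmod[of z] by (intro mult_left_mono) auto
  moreover have "0 < (1 - norm z) * (1 + a * norm z)"
    using a z by (intro mult_pos_pos add_pos_nonneg) auto
  moreover have "(1 - norm z) * (1 + a * norm z) = 1 - (1 - a) * norm z - a * (norm z)\<^sup>2"
    by (simp add: power2_eq_square algebra_simps)
  moreover have "Re ((1 - z) * cnj (1 + of_real a * z)) = 1 - (1 - a) * Re z - a * (norm z)\<^sup>2"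
    unfolding cmod_power2 by (simp add: power2_eq_square algebra_simps)
  ultimately show "0 < Re ((1 - z) * cnj (1 + of_real a * z))" by linarith
qed

lemma holomorphic_on_psiRL: "psiRL holomorphic_on ball 0 1"
  unfolding psiRL_def
proof (intro holomorphic_intros)
  fix z :: complex assume "z \<in> ball 0 1"
  then have pos: "0 < Re ((1 - z) / (1 + 2 * of_real (sqrt 2 - 1) * z))"
    using Re_Moebius_pos[of "2 * (sqrt 2 - 1)" z] sqrt_2_bounds by simp
  then show "1 + 2 * complex_of_real (sqrt 2 - 1) * z \<noteq> 0" by auto
  show "(1 - z) / (1 + 2 * complex_of_real (sqrt 2 - 1) * z) \<notin> \<real>\<^sub>\<le>\<^sub>0"
    using pos by (auto simp: complex_nonpos_Reals_iff)
qed

definition psiRL_neg :: "real \<Rightarrow> real" where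
  "psiRL_neg r = 1 + (sqrt 2 - 1) * (1 - sqrt ((1 + r) / (1 - 2 * (sqrt 2 - 1) * r)))"

lemma psiRL_neg_denom_pos:
  assumes "0 \<le> r" "r \<le> 1"
  shows "0 < 1 - 2 * (sqrt 2 - 1) * r"
proof -
  have "2 * (sqrt 2 - 1) * r \<le> 2 * (sqrt 2 - 1) * 1"
    using assms sqrt_2_bounds by (intro mult_left_mono) auto
  also have "\<dots> < 1" using sqrt_2_bounds by simp
  finally show ?thesis by simp
qed

lemma psiRL_minus_of_real:
  assumes "0 \<le> r" "r \<le> 1"
  shows "psiRL (- of_real r) = of_real (psiRL_neg r)"
proof -
  let ?q = "(1 + r) / (1 - 2 * (sqrt 2 - 1) * r)"
  have "psiRL (- of_real r) = of_real (sqrt 2) - of_real (sqrt 2 - 1) * csqrt (of_real ?q)"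
    by (simp add: psiRL_def)
  also have "csqrt (of_real ?q) = of_real (sqrt ?q)"
    using psiRL_neg_denom_pos[OF assms] assms by (subst csqrt_of_real_nonneg) auto
  finally show ?thesis by (simp add: psiRL_neg_def algebra_simps)
qed

lemma strict_antimono_on_psiRL_neg: "strict_antimono_on {0..1} psiRL_neg"
proof (rule monotone_onI)
  fix r t :: real assume "r \<in> {0..1}" "t \<in> {0..1}" "r < t"
  then have "(1 + r) / (1 - 2 * (sqrt 2 - 1) * r) < (1 + t) / (1 - 2 * (sqrt 2 - 1) * t)"
    using psiRL_neg_denom_pos[of t] sqrt_2_bounds by (intro frac_less) auto
  then show "psiRL_neg t < psiRL_neg r"
    using sqrt_2_bounds by (simp add: psiRL_neg_def)
qed

lemma norm_psiRL_minus_2_le: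
  assumes "norm z < 1"
  shows "norm (psiRL z - 2) \<le> 2 - psiRL_neg (norm z)"
proof -
  define k where "k = sqrt 2 - 1"
  have k: "0 < k" "k < 1" using sqrt_2_bounds by (auto simp: k_def)
  define s where "s = csqrt ((1 - z) / (1 + of_real (2 * k) * z))"
  have "norm s \<le> sqrt ((1 + norm z) / (1 - 2 * k * norm z))"
    using norm_Moebius_le[of "2 * k" z] psiRL_neg_denom_pos[of "norm z"] assms k(1)
    by (simp add: s_def k_def)
  then have "k * norm s \<le> k * sqrt ((1 + norm z) / (1 - 2 * k * norm z))"
    using k by (intro mult_left_mono) auto
  moreover have "2 - psiRL z = of_real (1 - k) + of_real k * s"
    by (simp add: psiRL_def s_def k_def)
  then have "norm (2 - psiRL z) \<le> (1 - k) + k * norm s"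
    using norm_triangle_ineq[of "of_real (1 - k)" "of_real k * s"] k
    by (simp only: norm_mult norm_of_real)
  ultimately show ?thesis
    unfolding psiRL_neg_def k_def[symmetric] norm_minus_commute[of "psiRL z"]
    by (simp add: right_diff_distrib)
qed

lemma psiRL_neg_Moebius:
  assumes "0 < q"
  shows "psiRL_neg ((q - 1) / (1 + 2 * (sqrt 2 - 1) * q)) = 1 + (sqrt 2 - 1) * (1 - sqrt q)"
proof -
  define k where "k = sqrt 2 - 1"
  have "0 < k" using sqrt_2_bounds by (simp add: k_def)
  define r where "r = (q - 1) / (1 + 2 * k * q)"
  have denom: "0 < 1 + 2 * k * q" using assms \<open>0 < k\<close> by (intro add_pos_pos mult_pos_pos) auto
  then have "1 + r = q * ((1 + 2 * k) / (1 + 2 * k * q))"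
    "1 - 2 * k * r = (1 + 2 * k) / (1 + 2 * k * q)"
    by (simp_all add: r_def field_simps)
  then have "(1 + r) / (1 - 2 * k * r) = q"
    using denom \<open>0 < k\<close> by simp
  then have "psiRL_neg r = 1 + k * (1 - sqrt q)"
    by (simp add: psiRL_neg_def flip: k_def)
  then show ?thesis by (simp only: r_def k_def)
qed

lemma is_radius_psiRL:
  "is_radius (starlike_class wp) (starlike_class psiRL)
     ((1 + 2 * (sqrt 2 - 1) * exp 1) /
      (exp 1 ^ 2 * (sqrt 2 - 1) * (sqrt 2 - 1 + 2 * (sqrt 2 - 1 + exp (-1)) ^ 2)))"
proof -
  define k where "k = sqrt 2 - 1"
  have k: "2 / 5 < k" "k < 1 / 2" using sqrt_2_bounds by (auto simp: k_def)
  define q where "q = (1 + exp (- 1) / k)\<^sup>2"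
  have "exp (- 1) / k < 1"
    using exp_minus_one_less k by simp
  then have q: "1 < q" "q < 4"
    using k power_strict_mono[of "1 + exp (- 1) / k" 2 2] by (auto simp: q_def one_less_power)
  define R where "R = (q - 1) / (1 + 2 * k * q)"
  have "q * (1 - 2 * k) \<le> 4 * (1 / 5)" using q k by (intro mult_mono) auto
  then have "q - 1 \<le> 1 + 2 * k * q" by (simp add: algebra_simps)
  then have R: "0 < R" "R \<le> 1" using q k by (simp_all add: R_def)
  have "psiRL_neg R = 1 + k * (1 - sqrt q)"
    unfolding R_def k_def using q(1) by (intro psiRL_neg_Moebius) simp
  then have psiRL_neg_R: "psiRL_neg R = 1 - exp (- 1)"
    using k by (simp add: q_def)
  have "is_radius (starlike_class wp) (starlike_class psiRL) R"
  proof (rule is_radius_starlike_wpI[where m = psiRL_neg])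
    show "strict_antimono_on {0..R} psiRL_neg"
      by (rule monotone_on_subset[OF strict_antimono_on_psiRL_neg]) (use R in auto)
    show "psiRL 0 = 1" by (simp add: psiRL_def)
  qed (use R psiRL_neg_R in
      \<open>auto simp: holomorphic_on_psiRL norm_psiRL_minus_2_le psiRL_minus_of_real\<close>)
  also have "R = (1 + 2 * k * exp 1) / (exp 1 ^ 2 * k * (k + 2 * (k + exp (- 1)) ^ 2))"
  proof -
    have "q - 1 = (1 + 2 * k * exp 1) / (exp 1 ^ 2 * k\<^sup>2)"
      using k by (simp add: q_def exp_minus field_simps power2_eq_square)
    moreover have "1 + 2 * k * q = (k + 2 * (k + exp (- 1)) ^ 2) / k"
      using k by (simp add: q_def field_simps power2_eq_square)
    ultimately show ?thesis using k by (simp add: R_def power2_eq_square)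
  qed
  finally show ?thesis by (simp only: k_def)
qed

subsection \<open>The exponential, cardioid and sine classes\<close>

lemma exp_minus_two_squared_le:
  fixes r x :: real
  assumes "- r \<le> x" "x \<le> r" "r \<le> 1 / 2"
  shows "(exp x - 2)\<^sup>2 + 2 * exp x * (r\<^sup>2 - x\<^sup>2) \<le> (2 - exp (- r))\<^sup>2"
proof -
  let ?F = "\<lambda>t. (exp t - 2)\<^sup>2 + 2 * exp t * (r\<^sup>2 - t\<^sup>2)"
  have "?F x \<le> ?F (- r)"
  proof (rule DERIV_nonpos_imp_nonincreasing[OF assms(1)])
    fix t assume t: "- r \<le> t" "t \<le> x"
    have "r * r \<le> r * (1 / 2)" using assms by (intro mult_left_mono) auto
    then have "exp t - 2 + (r\<^sup>2 - t\<^sup>2) - 2 * t \<le> 0"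
      using exp_le_quadratic[of t] t assms by (simp add: power2_eq_square)
    then have "2 * exp t * (exp t - 2 + (r\<^sup>2 - t\<^sup>2) - 2 * t) \<le> 0"
      by (intro mult_nonneg_nonpos) auto
    moreover have "(?F has_real_derivative 2 * exp t * (exp t - 2 + (r\<^sup>2 - t\<^sup>2) - 2 * t)) (at t)"
      by (auto intro!: derivative_eq_intros simp: algebra_simps power2_eq_square)
    ultimately show "\<exists>d. (?F has_real_derivative d) (at t) \<and> d \<le> 0" by blast
  qed
  then show ?thesis by (simp add: power2_commute)
qed

lemma norm_exp_minus_2_le:
  fixes z :: complex
  assumes "norm z \<le> 1 / 2"
  shows "norm (exp z - 2) \<le> 2 - exp (- norm z)"
proof (rule power2_le_imp_le)
  let ?x = "Re z" and ?y = "Im z"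
  have "(norm (exp z - 2))\<^sup>2 = (exp ?x - 2)\<^sup>2 + 4 * exp ?x * (1 - cos ?y)"
    using norm_diff_of_real_squared[of "exp z" 2]
    by (simp add: Re_exp power2_eq_square algebra_simps)
  also have "\<dots> \<le> (exp ?x - 2)\<^sup>2 + 4 * exp ?x * (?y\<^sup>2 / 2)"
    using cos_ge_quadratic[of ?y] by (intro add_left_mono mult_left_mono) auto
  also have "\<dots> = (exp ?x - 2)\<^sup>2 + 2 * exp ?x * ((norm z)\<^sup>2 - ?x\<^sup>2)"
    by (simp add: cmod_power2)
  also have "\<dots> \<le> (2 - exp (- norm z))\<^sup>2"
    using assms abs_Re_le_cmod[of z] by (intro exp_minus_two_squared_le) auto
  finally show "(norm (exp z - 2))\<^sup>2 \<le> (2 - exp (- norm z))\<^sup>2" .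
  have "exp (- norm z) \<le> 1" by simp
  then show "0 \<le> 2 - exp (- norm z)" by linarith
qed

lemma is_radius_psiE:
  "is_radius (starlike_class wp) (starlike_class psiE) (1 - ln (exp 1 - 1))"
proof -
  define R :: real where "R = 1 - ln (exp 1 - 1)"
  have "1 < exp (1 :: real)" by simp
  then have exp_R: "exp (- R) = 1 - exp (- 1)"
    by (simp add: R_def exp_diff exp_minus diff_divide_distrib inverse_eq_divide)
  then have "exp (- R) < exp 0" by simp
  then have "0 < R" by simp
  have "exp (- (1 / 2)) \<le> (5 / 8 :: real)"
  proof (rule power2_le_imp_le)
    have "(exp (- (1 / 2)))\<^sup>2 = exp (- 1 :: real)" by (simp flip: exp_double)
    then show "(exp (- (1 / 2)))\<^sup>2 \<le> (5 / 8 :: real)\<^sup>2"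
      using exp_minus_one_less by (simp add: power2_eq_square)
  qed simp
  then have "exp (- (1 / 2)) \<le> exp (- R)" unfolding exp_R using exp_minus_one_less by linarith
  then have "R \<le> 1 / 2" by simp
  have "is_radius (starlike_class wp) (starlike_class psiE) R"
  proof (rule is_radius_starlike_wpI[where m = "\<lambda>r. exp (- r)"])
    show "psiE holomorphic_on ball 0 1"
      unfolding psiE_def by (intro holomorphic_intros)
    show "norm (psiE z - 2) \<le> 2 - exp (- norm z)" if "norm z < R" for z
      using norm_exp_minus_2_le[of z] that \<open>R \<le> 1 / 2\<close> by (simp add: psiE_def)
    show "psiE (- of_real R) = of_real (exp (- R))"
      by (simp add: psiE_def flip: exp_of_real)
  qed (use \<open>0 < R\<close> \<open>R \<le> 1 / 2\<close> exp_R in \<open>simp_all add: psiE_def monotone_on_def\<close>)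
  then show ?thesis by (simp only: R_def)
qed

lemma norm_psiC_minus_2_le:
  assumes "norm z \<le> 2 / 5"
  shows "norm (psiC z - 2) \<le> 1 + 4 / 3 * norm z - 2 / 3 * (norm z)\<^sup>2"
proof (rule power2_le_imp_le)
  define x y r where "x = Re z" and "y = Im z" and "r = norm z"
  have r: "0 \<le> r" "r \<le> 2 / 5" "- r \<le> x"
    using assms abs_Re_le_cmod[of z] by (auto simp: r_def x_def)
  have y2: "y\<^sup>2 = r\<^sup>2 - x\<^sup>2" by (simp add: r_def x_def y_def cmod_power2)
  have r2: "r\<^sup>2 \<le> 2 / 5 * r" using mult_right_mono[OF r(2,1)] by (simp add: power2_eq_square)
  have "(norm (psiC z - 2))\<^sup>2 = (4/3 * x + 2/3 * (x\<^sup>2 - y\<^sup>2) - 1)\<^sup>2 + (4/3 * y + 4/3 * x * y)\<^sup>2"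
    unfolding cmod_power2
    by (simp add: psiC_def x_def y_def Re_power2 Im_power2 algebra_simps diff_divide_distrib)
  also have "(4/3 * y + 4/3 * x * y)\<^sup>2 = (4/3 + 4/3 * x)\<^sup>2 * y\<^sup>2"
    by (simp add: power2_eq_square algebra_simps)
  \<comment> \<open>the maximum on the circle is at \<open>x = -r\<close>, whence the factor \<open>x + r\<close>\<close>
  also have "(4/3 * x + 2/3 * (x\<^sup>2 - y\<^sup>2) - 1)\<^sup>2 + (4/3 + 4/3 * x)\<^sup>2 * y\<^sup>2
    = (1 + 4/3 * r - 2/3 * r\<^sup>2)\<^sup>2 - (x + r) * (8/3 * (1 + (x - r)) - 16/9 * r\<^sup>2)"
    unfolding y2 by (simp add: power2_eq_square field_simps)
  also have "\<dots> \<le> (1 + 4/3 * r - 2/3 * r\<^sup>2)\<^sup>2"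
    using r r2 by simp
  finally show "(norm (psiC z - 2))\<^sup>2 \<le> (1 + 4 / 3 * norm z - 2 / 3 * (norm z)\<^sup>2)\<^sup>2"
    by (simp only: r_def)
  show "0 \<le> 1 + 4 / 3 * norm z - 2 / 3 * (norm z)\<^sup>2"
    using r r2 by (simp flip: r_def)
qed

lemma is_radius_psiC:
  "is_radius (starlike_class wp) (starlike_class psiC) (1 - sqrt (1 - 3 / (2 * exp 1)))"
proof -
  define R :: real where "R = 1 - sqrt (1 - 3 / 2 * exp (- 1))"
  have "3 / 5 \<le> sqrt (1 - 3 / 2 * exp (- 1))"
    using exp_minus_one_less by (intro real_le_rsqrt) (simp add: power2_eq_square)
  then have R: "0 < R" "R \<le> 2 / 5" by (simp_all add: R_def)
  have "(1 - R)\<^sup>2 = 1 - 3 / 2 * exp (- 1)"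
    using exp_minus_one_less by (simp add: R_def)
  then have at_R: "1 - 4 / 3 * R + 2 / 3 * R\<^sup>2 = 1 - exp (- 1)"
    by (simp add: power2_eq_square algebra_simps)
  have "is_radius (starlike_class wp) (starlike_class psiC) R"
  proof (rule is_radius_starlike_wpI[where m = "\<lambda>r. 1 - 4 / 3 * r + 2 / 3 * r\<^sup>2"])
    show "psiC holomorphic_on ball 0 1"
      unfolding psiC_def by (intro holomorphic_intros)
    show "norm (psiC z - 2) \<le> 2 - (1 - 4 / 3 * norm z + 2 / 3 * (norm z)\<^sup>2)" if "norm z < R" for z
      using norm_psiC_minus_2_le[of z] that R by simp
    show "strict_antimono_on {0..R} (\<lambda>r. 1 - 4 / 3 * r + 2 / 3 * r\<^sup>2)"
    proof (rule monotone_onI)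
      fix r t assume "r \<in> {0..R}" "t \<in> {0..R}" "r < t"
      then have "0 < (t - r) * (2 - t - r)" using R by (intro mult_pos_pos) auto
      then show "1 - 4 / 3 * t + 2 / 3 * t\<^sup>2 < 1 - 4 / 3 * r + 2 / 3 * r\<^sup>2"
        by (simp add: power2_eq_square algebra_simps)
    qed
  qed (use R at_R in \<open>simp_all add: psiC_def\<close>)
  then show ?thesis by (simp add: R_def exp_minus inverse_eq_divide)
qed

lemma norm_sin_minus_1: "norm (sin z - 1) = cosh (Im z) - sin (Re z)"
proof (rule power2_eq_imp_eq)
  let ?x = "Re z" and ?y = "Im z"
  have "(norm (sin z))\<^sup>2 = (sin ?x)\<^sup>2 * (cosh ?y)\<^sup>2 + (cos ?x)\<^sup>2 * (sinh ?y)\<^sup>2"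
    by (simp add: cmod_power2 Re_sin Im_sin cosh_field_def sinh_field_def power_mult_distrib power_divide)
  also have "\<dots> = (sin ?x)\<^sup>2 + (cosh ?y)\<^sup>2 - 1"
    by (simp add: cos_squared_eq sinh_square_eq algebra_simps)
  finally show "(norm (sin z - 1))\<^sup>2 = (cosh ?y - sin ?x)\<^sup>2"
    using norm_diff_of_real_squared[of "sin z" 1]
    by (simp add: Re_sin cosh_field_def power2_diff)
  show "0 \<le> cosh ?y - sin ?x"
    using cosh_real_ge_1[of ?y] sin_le_one[of ?x] by linarith
qed auto

lemma norm_sin_minus_1_le:
  fixes z :: complex
  assumes "norm z \<le> 7 / 16"
  shows "norm (sin z - 1) \<le> 1 + sin (norm z)"
proof -
  define x y r where "x = Re z" and "y = Im z" and "r = norm z"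
  have r: "r \<le> 7 / 16" "- r \<le> x" "x \<le> r" "\<bar>y\<bar> \<le> r"
    using assms abs_Re_le_cmod[of z] abs_Im_le_cmod[of z] by (auto simp: r_def x_def y_def)
  have "y\<^sup>2 = (r + x) * (r - x)"
    using cmod_power2[of z] by (simp add: r_def x_def y_def power2_eq_square algebra_simps)
  also have "\<dots> \<le> (r + x) * (7 / 8)" using r by (intro mult_left_mono) auto
  also have "\<dots> \<le> sin r + sin x"
    using sin_diff_ge[of "- x" r "1 / 2"] r by (simp add: power2_eq_square)
  finally have "cosh y \<le> 1 + (sin r + sin x)"
    using cosh_le_quadratic[of y] r by simp
  then show ?thesis
    by (simp add: norm_sin_minus_1 r_def x_def y_def)
qed

lemma is_radius_psiS:
  "is_radius (starlike_class wp) (starlike_class psiS) (arcsin (1 / exp 1))"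
proof -
  define R :: real where "R = arcsin (exp (- 1))"
  have range: "- 1 \<le> exp (- 1 :: real)" "exp (- 1 :: real) \<le> 1"
    using exp_gt_zero[of "- 1 :: real"] exp_minus_one_less by linarith+
  then have sin_R: "sin R = exp (- 1)" by (simp add: R_def sin_arcsin)
  have "0 < R"
    using arcsin_less_arcsin[of 0 "exp (- 1)"] by (simp add: R_def)
  have "exp (- 1) \<le> sin (7 / 16 :: real)"
    using sin_diff_ge[of 0 "7 / 16" "1 / 2"] exp_minus_one_less by (simp add: power2_eq_square)
  then have "R \<le> 7 / 16"
    unfolding R_def using pi_gt3 range by (subst arcsin_le_iff) auto
  have "is_radius (starlike_class wp) (starlike_class psiS) R"
  proof (rule is_radius_starlike_wpI[where m = "\<lambda>r. 1 - sin r"])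
    show "psiS holomorphic_on ball 0 1"
      unfolding psiS_def by (intro holomorphic_intros)
    show "norm (psiS z - 2) \<le> 2 - (1 - sin (norm z))" if "norm z < R" for z
      using norm_sin_minus_1_le[of z] that \<open>R \<le> 7 / 16\<close> by (simp add: psiS_def)
    show "strict_antimono_on {0..R} (\<lambda>r. 1 - sin r)"
      using \<open>R \<le> 7 / 16\<close> pi_gt3 by (auto simp: monotone_on_def intro!: sin_monotone_2pi)
    show "psiS (- of_real R) = of_real (1 - sin R)"
      by (simp add: psiS_def sin_of_real)
  qed (use \<open>0 < R\<close> \<open>R \<le> 7 / 16\<close> sin_R in \<open>simp_all add: psiS_def\<close>)
  then show ?thesis by (simp add: R_def exp_minus inverse_eq_divide)
qed

subsection \<open>The crescent class\<close>

lemma inverse_psiDelta: "inverse (psiDelta z) = csqrt (1 + z\<^sup>2) - z"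
proof (rule inverse_unique)
  show "psiDelta z * (csqrt (1 + z\<^sup>2) - z) = 1"
    using power2_csqrt[of "1 + z\<^sup>2"] by (simp add: psiDelta_def power2_eq_square algebra_simps)
qed

lemma psiDelta_nonzero: "psiDelta z \<noteq> 0"
proof
  assume "psiDelta z = 0"
  moreover from this have "csqrt (1 + z\<^sup>2) = z" using inverse_psiDelta[of z] by simp
  then have "1 + z\<^sup>2 = z\<^sup>2" by (metis power2_csqrt)
  then show False by simp
qed

lemma Re_psiDelta_nonneg: "0 \<le> Re (psiDelta z)"
proof -
  let ?s = "psiDelta z"
  have "Re ?s * (1 + inverse ((norm ?s)\<^sup>2)) = Re (?s + inverse ?s)"
    by (simp add: complex_inverse cmod_power2 divide_inverse algebra_simps)
  also have "\<dots> = 2 * Re (csqrt (1 + z\<^sup>2))"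
    by (simp add: inverse_psiDelta) (simp add: psiDelta_def)
  finally have "0 \<le> Re ?s * (1 + inverse ((norm ?s)\<^sup>2))"
    using Re_csqrt[of "1 + z\<^sup>2"] by simp
  moreover have "0 < 1 + inverse ((norm ?s)\<^sup>2)" by (intro add_pos_nonneg) auto
  ultimately show ?thesis by (simp add: zero_le_mult_iff)
qed

lemma norm_psiDelta_squared:
  "4 * (norm z)\<^sup>2 * (norm (psiDelta z))\<^sup>2 = ((norm (psiDelta z))\<^sup>2 + 1)\<^sup>2 - 4 * (Re (psiDelta z))\<^sup>2"
proof -
  let ?s = "psiDelta z"
  have "2 * z = ?s - inverse ?s"
    by (simp add: inverse_psiDelta) (simp add: psiDelta_def)
  then have "2 * z * ?s = ?s\<^sup>2 - 1"
    using psiDelta_nonzero[of z] by (simp add: field_simps power2_eq_square)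
  then have "(norm (2 * z * ?s))\<^sup>2 = (norm (?s\<^sup>2 - 1))\<^sup>2" by simp
  then have "4 * (norm z)\<^sup>2 * (norm ?s)\<^sup>2 = (norm (?s\<^sup>2 - 1))\<^sup>2"
    by (simp add: norm_mult power_mult_distrib)
  also have "\<dots> = ((norm ?s)\<^sup>2 + 1)\<^sup>2 - 4 * (Re ?s)\<^sup>2"
    unfolding cmod_power2 by (simp add: power2_eq_square algebra_simps)
  finally show ?thesis .
qed

lemma sqrt_one_plus_square_minus_eq_inverse:
  "sqrt (1 + r\<^sup>2) - r = inverse (sqrt (1 + r\<^sup>2) + r)" for r :: real
proof (rule inverse_unique[symmetric])
  have "(sqrt (1 + r\<^sup>2))\<^sup>2 = 1 + r\<^sup>2" by simp
  then show "(sqrt (1 + r\<^sup>2) + r) * (sqrt (1 + r\<^sup>2) - r) = 1"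
    by (simp add: power2_eq_square algebra_simps)
qed

lemma norm_psiDelta_ge: "sqrt (1 + (norm z)\<^sup>2) - norm z \<le> norm (psiDelta z)"
proof (rule inverse_le_imp_le)
  have "inverse (norm (psiDelta z)) = norm (csqrt (1 + z\<^sup>2) - z)"
    by (simp add: inverse_psiDelta flip: norm_inverse)
  also have "\<dots> \<le> norm (csqrt (1 + z\<^sup>2)) + norm z"
    by (rule norm_triangle_ineq4)
  also have "\<dots> \<le> sqrt (1 + (norm z)\<^sup>2) + norm z"
    using norm_triangle_ineq[of 1 "z\<^sup>2"] by (simp add: norm_power)
  finally show "inverse (norm (psiDelta z)) \<le> inverse (sqrt (1 + (norm z)\<^sup>2) - norm z)"
    by (simp add: sqrt_one_plus_square_minus_eq_inverse)
qed (simp add: psiDelta_nonzero)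

lemma sqrt_one_plus_square_minus_bounds:
  fixes r :: real
  assumes "0 \<le> r" "r \<le> 1 / 2"
  shows "3 / 5 \<le> sqrt (1 + r\<^sup>2) - r" "sqrt (1 + r\<^sup>2) - r \<le> 1"
proof -
  have "3 / 5 + r \<le> sqrt (1 + r\<^sup>2)"
    using assms by (intro real_le_rsqrt) (simp add: power2_eq_square algebra_simps)
  then show "3 / 5 \<le> sqrt (1 + r\<^sup>2) - r" by simp
  have "sqrt (1 + r\<^sup>2) \<le> 1 + r"
    using assms by (intro real_le_lsqrt) (auto simp: power2_eq_square algebra_simps)
  then show "sqrt (1 + r\<^sup>2) - r \<le> 1" by simp
qed

lemma norm_psiDelta_minus_2_le:
  assumes "norm z \<le> 1 / 2"
  shows "norm (psiDelta z - 2) \<le> 2 - (sqrt (1 + (norm z)\<^sup>2) - norm z)"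
proof -
  define r b x P where "r = norm z" and "b = sqrt (1 + r\<^sup>2) - r"
    and "x = Re (psiDelta z)" and "P = (norm (psiDelta z))\<^sup>2"
  have r: "0 \<le> r" "r \<le> 1 / 2" using assms by (simp_all add: r_def)
  have b: "3 / 5 \<le> b" "b \<le> 1"
    unfolding b_def using sqrt_one_plus_square_minus_bounds[OF r] by auto
  have "(b + r)\<^sup>2 = 1 + r\<^sup>2" by (simp add: b_def)
  then have br: "2 * b * r = 1 - b\<^sup>2" by (simp add: power2_eq_square algebra_simps)
  have "b \<le> norm (psiDelta z)" using norm_psiDelta_ge by (simp add: b_def r_def)
  then have P: "b\<^sup>2 \<le> P" using b by (simp add: P_def power_mono)
  have "0 \<le> (b - 3 / 5) * (17 / 5 - b)" using b by simp
  then have "2 \<le> b * (4 - b)" by (simp add: field_simps)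
  then have "2\<^sup>2 \<le> (b * (4 - b))\<^sup>2" by (intro power_mono) auto
  then have "0 \<le> (P - b\<^sup>2) * (3 * b\<^sup>2 * P + ((b * (4 - b))\<^sup>2 - 2\<^sup>2))"
    using P by (intro mult_nonneg_nonneg add_nonneg_nonneg) (auto simp: P_def)
  \<comment> \<open>equality holds for \<open>psiDelta z = b\<close>, whence the factor \<open>P - b\<^sup>2\<close>\<close>
  also have "\<dots> = b\<^sup>2 * (4 * (P + 1)\<^sup>2 - (P + 4 * b - b\<^sup>2)\<^sup>2) - 4 * ((2 * b * r)\<^sup>2 * P)"
    unfolding br by (simp add: power2_eq_square algebra_simps)
  also have "\<dots> = b\<^sup>2 * (4 * ((P + 1)\<^sup>2 - 4 * r\<^sup>2 * P) - (P + 4 * b - b\<^sup>2)\<^sup>2)"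
    by (simp add: power_mult_distrib algebra_simps)
  also have "(P + 1)\<^sup>2 - 4 * r\<^sup>2 * P = 4 * x\<^sup>2"
    using norm_psiDelta_squared[of z] by (simp add: r_def x_def P_def)
  also have "4 * (4 * x\<^sup>2) = (4 * x)\<^sup>2" by (simp add: power_mult_distrib)
  finally have "(P + 4 * b - b\<^sup>2)\<^sup>2 \<le> (4 * x)\<^sup>2"
    using b by (simp add: zero_le_mult_iff)
  then have "P + 4 * b - b\<^sup>2 \<le> 4 * x"
    by (rule power2_le_imp_le) (simp add: x_def Re_psiDelta_nonneg)
  then have "(norm (psiDelta z - 2))\<^sup>2 \<le> (2 - b)\<^sup>2"
    using norm_diff_of_real_squared[of "psiDelta z" 2]
    by (simp add: x_def P_def power2_diff)
  then show ?thesis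
    using b by (auto simp: b_def r_def intro: power2_le_imp_le)
qed

lemma is_radius_psiDelta:
  "is_radius (starlike_class wp) (starlike_class psiDelta)
     ((2 * exp 1 - 1) / (2 * exp 1 * (exp 1 - 1)))"
proof -
  define b where "b = 1 - exp (- 1 :: real)"
  have b: "5 / 8 < b" "b < 1" using exp_minus_one_less by (auto simp: b_def)
  define R where "R = (1 - b\<^sup>2) / (2 * b)"
  have "(5 / 8)\<^sup>2 \<le> b\<^sup>2" "b\<^sup>2 < 1" using b by (auto simp: power_mono abs_square_less_1)
  then have R: "0 < R" "R \<le> 1 / 2" using b by (simp_all add: R_def power2_eq_square field_simps)
  have "sqrt (1 + R\<^sup>2) = b + R"
  proof (rule real_sqrt_unique)
    show "(b + R)\<^sup>2 = 1 + R\<^sup>2"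
      using b by (simp add: R_def power2_sum)
  qed (use b R in simp)
  then have at_R: "sqrt (1 + R\<^sup>2) - R = 1 - exp (- 1)" by (simp add: b_def)
  have "is_radius (starlike_class wp) (starlike_class psiDelta) R"
  proof (rule is_radius_starlike_wpI[where m = "\<lambda>r. sqrt (1 + r\<^sup>2) - r"])
    show "psiDelta holomorphic_on ball 0 1"
      unfolding psiDelta_def
    proof (intro holomorphic_intros one_plus_notin_nonpos_Reals)
      show "norm (z\<^sup>2) < 1" if "z \<in> ball 0 1" for z :: complex
        using that by (simp add: norm_power power_less_one_iff)
    qed
    show "norm (psiDelta z - 2) \<le> 2 - (sqrt (1 + (norm z)\<^sup>2) - norm z)" if "norm z < R" for z
      using that R by (intro norm_psiDelta_minus_2_le) simp
    show "strict_antimono_on {0..R} (\<lambda>r. sqrt (1 + r\<^sup>2) - r)"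
      unfolding sqrt_one_plus_square_minus_eq_inverse
      by (auto simp: monotone_on_def intro!: less_imp_inverse_less add_strict_mono add_pos_nonneg
          power_strict_mono)
    show "psiDelta (- of_real R) = of_real (sqrt (1 + R\<^sup>2) - R)"
      using csqrt_of_real_nonneg[of "of_real (1 + R\<^sup>2)"] by (simp add: psiDelta_def)
  qed (use R at_R in \<open>simp_all add: psiDelta_def\<close>)
  also have "R = (2 * exp 1 - 1) / (2 * exp 1 * (exp 1 - 1))"
    by (simp add: R_def b_def exp_minus field_simps power2_eq_square)
  finally show ?thesis .
qed

theorem mainTheorem11:
  shows "is_radius (starlike_class wp) (starlike_class psiL) ((2 * exp 1 - 1) / exp 1 ^ 2)
    \<and> is_radius (starlike_class wp) (starlike_class psiRL)
        ((1 + 2 * (sqrt 2 - 1) * exp 1) /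
         (exp 1 ^ 2 * (sqrt 2 - 1) * (sqrt 2 - 1 + 2 * (sqrt 2 - 1 + exp (-1)) ^ 2)))
    \<and> is_radius (starlike_class wp) (starlike_class psiE) (1 - ln (exp 1 - 1))
    \<and> is_radius (starlike_class wp) (starlike_class psiC) (1 - sqrt (1 - 3 / (2 * exp 1)))
    \<and> is_radius (starlike_class wp) (starlike_class psiS) (arcsin (1 / exp 1))
    \<and> is_radius (starlike_class wp) (starlike_class psiDelta)
        ((2 * exp 1 - 1) / (2 * exp 1 * (exp 1 - 1)))"
  by (intro conjI is_radius_psiL is_radius_psiRL is_radius_psiE is_radius_psiC is_radius_psiS
      is_radius_psiDelta)

end
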